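(* For every tree $G$ on $n\geq 3$ vertices, \[ ecc(G)-\rho(G)\leq ecc(P_n)-\rho(P_n), \] where $P_n$ is the path on $n$ vertices. That is, among trees on $n\geq3$ vertices the difference $ecc-\rho$ is maximum for $P_n$.
   Context: $d(u,v)$ is the length of a shortest $u$–$v$ path. The eccentricity of a vertex is $e(v)=\max_{u\in V}d(v,u)$ and the average eccentricity is $ecc(G)=\frac1n\sum_{v\in V}e(v)$. The normalized transmission of $v$ is $\pi(v)=\frac{1}{n-1}\sum_{u\in V}d(v,u)$ and the remoteness is $\rho(G)=\max_{v\in V}\pi(v)$. *)

theory Defs
  imports "Graph_Theory.Graph_Theory"
begin

text \<open>
  Finite simple graphs are the symmetric, loop-free digraphs without parallel arcs of the
  locale \<^locale>\<open>graph\<close>.  Every edge is then a pair of opposite arcs, which form a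
  \<^const>\<open>pre_digraph.cycle\<close> of length 2, so the library's \<^const>\<open>tree\<close> admits no symmetric
  digraph with an edge.  A cycle of the underlying simple graph is a directed cycle of
  length at least 3.
\<close>

definition simple_tree :: "('a, 'b) pre_digraph \<Rightarrow> bool" where
  "simple_tree G \<longleftrightarrow>
     graph G \<and> Digraph_Component.connected G \<and>
     \<not> (\<exists>p. pre_digraph.cycle G p \<and> 3 \<le> length p)"

text \<open>Only meaningful if some path joins \<open>u\<close> and \<open>v\<close>, as is always the case in a connected graph.\<close>

definition graph_dist :: "('a, 'b) pre_digraph \<Rightarrow> 'a \<Rightarrow> 'a \<Rightarrow> nat" where
  "graph_dist G u v = (LEAST k. \<exists>p. vpath p G \<and> hd p = u \<and> last p = v \<and> vwalk_length p = k)"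

definition eccentricity :: "('a, 'b) pre_digraph \<Rightarrow> 'a \<Rightarrow> nat" where
  "eccentricity G v = Max (graph_dist G v ` verts G)"

definition average_eccentricity :: "('a, 'b) pre_digraph \<Rightarrow> real" where
  "average_eccentricity G =
     1 / real (card (verts G)) * (\<Sum>v\<in>verts G. real (eccentricity G v))"

definition normalized_transmission :: "('a, 'b) pre_digraph \<Rightarrow> 'a \<Rightarrow> real" where
  "normalized_transmission G v =
     1 / (real (card (verts G)) - 1) * (\<Sum>u\<in>verts G. real (graph_dist G v u))"

definition remoteness :: "('a, 'b) pre_digraph \<Rightarrow> real" where
  "remoteness G = Max (normalized_transmission G ` verts G)"

definition path_graph :: "nat \<Rightarrow> nat pair_pre_digraph" where
  "path_graph n = \<lparr> pverts = {..<n},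
     parcs = {(i, j). i < n \<and> j < n \<and> (j = Suc i \<or> i = Suc j)} \<rparr>"

end

theory Submission
  imports Defs
begin

text \<open>
  Let \<open>a\<close>, \<open>b\<close> be at distance equal to the diameter \<open>D\<close> of the tree, and put
  \<open>W = (\<Sum>u. d a u + d b u)\<close>.  Every eccentricity is
  \<open>e u = max (d a u) (d b u) = (d a u + d b u + \<bar>d a u - d b u\<bar>) / 2\<close>, while the remoteness is at
  least the mean \<open>W / (2 * (n - 1))\<close> of the normalized transmissions of \<open>a\<close> and \<open>b\<close>.  As
  \<open>W \<ge> n * D\<close>, it remains to bound \<open>\<Sum>u. \<bar>d a u - d b u\<bar>\<close>.  The \<open>D + 1\<close> vertices of the
  path from \<open>a\<close> to \<open>b\<close> contribute \<open>\<Sum>i\<le>D. \<bar>2 * i - D\<bar>\<close>, and any other vertex contributes at most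
  \<open>D - 2\<close>, since by parity \<open>d a u + d b u \<ge> D + 2\<close>.  The resulting bound increases with \<open>D\<close>
  and is attained by the path, where \<open>D = n - 1\<close>.
\<close>

section \<open>Distances in a connected graph\<close>

lemma vwalk_imp_relpow:
  assumes "vwalk p G"
  shows "(hd p, last p) \<in> arcs_ends G ^^ (length p - 1)"
  using assms
proof (induct p rule: vwalk_induct)
  case (Cons u v es)
  then show ?case using relpow_Suc_I2[of u v "arcs_ends G" "last (v # es)" "length es"] by simp
qed simp

lemma (in wf_digraph) relpow_imp_vwalk:
  assumes "(u, v) \<in> arcs_ends G ^^ k" "u \<in> verts G"
  shows "\<exists>p. vwalk p G \<and> hd p = u \<and> last p = v \<and> length p = Suc k"
  using assms
proof (induct k arbitrary: u)
  case 0
  then have "vwalk [u] G \<and> hd [u] = u \<and> last [u] = v \<and> length [u] = Suc 0" by simp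
  then show ?case by blast
next
  case (Suc k)
  from Suc.prems(1) obtain w where w: "(u, w) \<in> arcs_ends G" "(w, v) \<in> arcs_ends G ^^ k"
    by (meson relpow_Suc_D2)
  with Suc.hyps adj_in_verts(2) obtain p
    where p: "vwalk p G" "hd p = w" "last p = v" "length p = Suc k" by meson
  then have "vwalk (u # p) G \<and> hd (u # p) = u \<and> last (u # p) = v \<and> length (u # p) = Suc (Suc k)"
    using w(1) vwalk_wf_digraph_consI[OF p(1), of u] by auto
  then show ?case by blast
qed

lemma length_vwalk_to_vpath_le: "length (vwalk_to_vpath p) \<le> length p"
proof (induct p rule: vwalk_to_vpath_induct3)
  case (in_set x xs)
  then show ?case using length_dropWhile_le[of "\<lambda>y. y \<noteq> x" xs] by simp
qed auto

text \<open>Cutting a walk down to a path never lengthens it, so minimising over paths or over walks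
  gives the same value. Distances thereby become exponents of the adjacency relation, and triangle
  inequality, symmetry and splitting follow from the algebra of relation powers.\<close>

lemma (in wf_digraph) graph_dist_eq_Least_relpow:
  assumes "u \<in> verts G" "u \<rightarrow>\<^sup>*\<^bsub>G\<^esub> v"
  shows "graph_dist G u v = (LEAST k. (u, v) \<in> arcs_ends G ^^ k)"
proof -
  let ?k = "LEAST k. (u, v) \<in> arcs_ends G ^^ k"
  have "\<exists>k. (u, v) \<in> arcs_ends G ^^ k"
    using assms by (meson reachable_rtranclI rtrancl_imp_relpow)
  then have "(u, v) \<in> arcs_ends G ^^ ?k" by (rule LeastI_ex)
  then obtain p where p: "vwalk p G" "hd p = u" "last p = v" "length p = Suc ?k"
    using relpow_imp_vwalk assms(1) by blast
  have least: "?k \<le> length q - 1" if "vwalk q G" "hd q = u" "last q = v" for q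
    using vwalk_imp_relpow[OF that(1)] that by (simp add: Least_le)
  let ?q = "vwalk_to_vpath p"
  have q: "vpath ?q G" "hd ?q = u" "last ?q = v"
    using p by (simp_all add: vwalk_to_vpath_vpath vwalk_to_vpath_hd vwalk_to_vpath_last)
  have "length ?q - 1 = ?k"
    using length_vwalk_to_vpath_le[of p] p(4) least[of ?q] q by (auto simp: vpath_def)
  then show ?thesis
    unfolding graph_dist_def using q least
    by (intro Least_equality) (auto simp: vpath_def)
qed

locale connected_graph = graph +
  assumes connected: "Digraph_Component.connected G"
begin

abbreviation d :: "'a \<Rightarrow> 'a \<Rightarrow> nat" where "d \<equiv> graph_dist G"

lemma reachable_verts:
  assumes "u \<in> verts G" "v \<in> verts G"
  shows "u \<rightarrow>\<^sup>*\<^bsub>G\<^esub> v"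
  using symmetric_connected_imp_strongly_connected[OF sym_arcs connected] assms by auto

lemma verts_nonempty: "verts G \<noteq> {}"
  using connected by (simp add: connected_conv)

lemma dist_relpow:
  assumes "u \<in> verts G" "v \<in> verts G"
  shows "(u, v) \<in> arcs_ends G ^^ d u v"
proof -
  have "\<exists>k. (u, v) \<in> arcs_ends G ^^ k"
    using reachable_verts[OF assms] by (meson reachable_rtranclI rtrancl_imp_relpow)
  then show ?thesis
    unfolding graph_dist_eq_Least_relpow[OF assms(1) reachable_verts[OF assms]]
    by (rule LeastI_ex)
qed

lemma relpow_in_verts:
  assumes "(u, v) \<in> arcs_ends G ^^ k" "u \<in> verts G"
  shows "v \<in> verts G"
  using relpow_imp_vwalk[OF assms] by (metis last_in_set vwalkE subsetD)

lemma dist_le: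
  assumes "(u, v) \<in> arcs_ends G ^^ k" "u \<in> verts G"
  shows "d u v \<le> k"
  unfolding graph_dist_eq_Least_relpow[OF assms(2)
      reachable_verts[OF assms(2) relpow_in_verts[OF assms]]]
  by (rule Least_le) (rule assms)

lemma dist_self [simp]: "u \<in> verts G \<Longrightarrow> d u u = 0"
  using dist_le[of u u 0] by simp

lemma dist_eq_0_imp_eq:
  assumes "u \<in> verts G" "v \<in> verts G" "d u v = 0"
  shows "u = v"
  using dist_relpow[OF assms(1,2)] assms(3) by simp

lemma dist_commute:
  assumes "u \<in> verts G" "v \<in> verts G"
  shows "d u v = d v u"
proof -
  have "(x, y) \<in> arcs_ends G ^^ k \<Longrightarrow> (y, x) \<in> arcs_ends G ^^ k" for x y k
  proof (induct k arbitrary: y)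
    case (Suc k)
    then obtain z where z: "(x, z) \<in> arcs_ends G ^^ k" "(z, y) \<in> arcs_ends G" by auto
    show ?case
      by (rule relpow_Suc_I2[OF arcs_ends_symmetric[OF sym_arcs z(2)] Suc.hyps[OF z(1)]])
  qed simp
  then show ?thesis
    using assms by (meson dist_le dist_relpow order_antisym)
qed

lemma dist_triangle:
  assumes "u \<in> verts G" "v \<in> verts G" "w \<in> verts G"
  shows "d u w \<le> d u v + d v w"
proof (rule dist_le)
  show "(u, w) \<in> arcs_ends G ^^ (d u v + d v w)"
    unfolding relpow_add using assms dist_relpow by blast
qed fact

lemma adj_dist_le:
  assumes "r \<in> verts G" "(u, v) \<in> arcs_ends G"
  shows "d r v \<le> Suc (d r u)"
proof (rule dist_le)
  show "(r, v) \<in> arcs_ends G ^^ Suc (d r u)"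
    using assms adj_in_verts dist_relpow by (meson relpow_Suc_I)
qed fact

lemma adj_sym: "(u, v) \<in> arcs_ends G \<Longrightarrow> (v, u) \<in> arcs_ends G"
  using arcs_ends_symmetric[OF sym_arcs] .

lemma geodesic_split:
  assumes "u \<in> verts G" "v \<in> verts G" "d u v = i + j"
  obtains w where "w \<in> verts G" "d u w = i" "d w v = j"
proof -
  obtain w where w: "(u, w) \<in> arcs_ends G ^^ i" "(w, v) \<in> arcs_ends G ^^ j"
    using dist_relpow[OF assms(1,2)] unfolding assms(3) relpow_add by blast
  then have "w \<in> verts G" using relpow_in_verts assms by blast
  moreover from this have "d u w \<le> i" "d w v \<le> j" using w assms by (auto intro: dist_le)
  ultimately show thesis
    using that[of w] dist_triangle[of u w v] assms by auto
qed

lemma geodesic_last_arc: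
  assumes "u \<in> verts G" "v \<in> verts G" "d u v = Suc k"
  obtains w where "d u w = k" "(w, v) \<in> arcs_ends G"
proof -
  obtain w where w: "w \<in> verts G" "d u w = k" "d w v = 1"
    using geodesic_split[of u v k 1] assms by auto
  then have "(w, v) \<in> arcs_ends G" using dist_relpow[of w v] assms by simp
  with that w show thesis by blast
qed

end

section \<open>Levels in a tree\<close>

locale acyclic_graph = connected_graph +
  assumes no_cycle: "cycle p \<Longrightarrow> length p < 3"
begin

text \<open>Such an arc would close the path to a cycle with at least three arcs. The bound on
  \<open>length p\<close> leaves out the 2-cycles formed by opposite arcs.\<close>

lemma adj_not_apath:
  assumes "apath x p y" "2 \<le> length p"
  shows "(y, x) \<notin> arcs_ends G"
proof
  assume "(y, x) \<in> arcs_ends G"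
  then obtain e where e: "e \<in> arcs G" "tail G e = y" "head G e = x" by (rule reachableE)
  have aw: "awalk x p y" and dist: "distinct (awalk_verts x p)"
    using assms(1) by (auto simp: apath_def)
  have "awalk y [e] x" using e by (auto simp: awalk_simps)
  with aw have aw': "awalk x (p @ [e]) x" by auto
  obtain vs where vs: "awalk_verts x p = x # vs"
    using aw by (cases p) (auto simp: awalk_simps)
  have "awalk_verts x (p @ [e]) = awalk_verts x p @ [x]"
    using awalk_verts_append[OF aw'] e aw by simp
  then have "distinct (tl (awalk_verts x (p @ [e])))" using dist vs by simp
  then have "cycle (p @ [e])" using aw' by (auto simp: cycle_def)
  from no_cycle[OF this] assms(2) show False by simp
qed

text \<open>
  The path is formed by geodesics from \<open>x\<close> and \<open>y\<close> towards \<open>r\<close>, cut where they first meet.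
\<close>

lemma ex_apath_same_level:
  assumes "r \<in> verts G" "x \<in> verts G" "y \<in> verts G" "x \<noteq> y" "d r x = k" "d r y = k"
  shows "\<exists>p. apath x p y \<and> 2 \<le> length p \<and> (\<forall>z \<in> set (awalk_verts x p). d r z \<le> k)"
  using assms(2-)
proof (induct k arbitrary: x y)
  case 0
  then have "r = x" "r = y" using dist_eq_0_imp_eq[OF assms(1)] by blast+
  then show ?case using 0 by simp
next
  case (Suc k)
  obtain x' where x': "d r x' = k" "(x', x) \<in> arcs_ends G"
    using geodesic_last_arc[OF assms(1) Suc.prems(1,4)] .
  obtain y' where y': "d r y' = k" "(y', y) \<in> arcs_ends G"
    using geodesic_last_arc[OF assms(1) Suc.prems(2,5)] .
  obtain e where e: "e \<in> arcs G" "tail G e = x" "head G e = x'"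
    using adj_sym[OF x'(2)] by (rule reachableE)
  obtain f where f: "f \<in> arcs G" "tail G f = y'" "head G f = y"
    using y'(2) by (rule reachableE)
  have verts: "x' \<in> verts G" "y' \<in> verts G" using x'(2) y'(2) adj_in_verts by auto
  show ?case
  proof (cases "x' = y'")
    case True
    have "tail G f = head G e" using e(3) f(2) True by simp
    moreover have "x \<noteq> head G e" "y \<noteq> head G e"
      using e(3) True x'(1) y'(1) Suc.prems(4,5) by auto
    moreover have "y \<in> verts G" by fact
    ultimately have "apath x [e, f] y"
      using e(1,2) f(1,3) \<open>x \<noteq> y\<close> by (simp add: apath_simps)
    moreover have "\<forall>z \<in> set (awalk_verts x [e, f]). d r z \<le> Suc k"
      using e(2) f x'(1) y'(1) True Suc.prems(4,5) by simp
    ultimately show ?thesis by (intro exI[of _ "[e, f]"]) simp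
  next
    case False
    then obtain p where p: "apath x' p y'" "2 \<le> length p"
      and lev: "\<forall>z \<in> set (awalk_verts x' p). d r z \<le> k"
      using Suc.hyps[of x' y'] verts x' y' by auto
    have aw: "awalk x' p y'" using p by (simp add: apath_def)
    have last: "awlast x' p = y'" using aw by simp
    \<comment> \<open>The inductive path uses only levels up to \<open>k\<close>, while
      \<open>x\<close> and \<open>y\<close> lie on level \<open>k + 1\<close>. This is what the
      level bound in the claim is for: the extended path repeats no vertex.\<close>
    have notin: "x \<notin> set (awalk_verts x' p)" "y \<notin> set (awalk_verts x' p)"
      using lev Suc.prems by force+
    have ne: "y' \<noteq> y" using y' Suc.prems by auto
    have "apath y' [f] y" using f Suc.prems ne by (auto simp: apath_simps)
    then have ap: "apath x' (p @ [f]) y"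
      using p notin last f by (simp add: apath_append_iff)
    have "awalk x' (p @ [f]) y" using ap by (simp add: apath_def)
    then have av: "awalk_verts x' (p @ [f]) = awalk_verts x' p @ [y]"
      using awalk_verts_append[of x' p "[f]" y] last f by simp
    have "apath x (e # p @ [f]) y"
      using ap av notin e Suc.prems by (simp add: apath_Cons_iff)
    moreover have "\<forall>z \<in> set (awalk_verts x (e # p @ [f])). d r z \<le> Suc k"
      using av e lev Suc.prems by auto
    ultimately show ?thesis using p(2) by (intro exI[of _ "e # p @ [f]"]) simp
  qed
qed

text \<open>The levels of adjacent vertices differ by at most one. If they agreed, the two vertices
  would also be joined by a path of length at least 2, which the arc would close to a cycle.\<close>

lemma adj_level:
  assumes "r \<in> verts G" "(u, v) \<in> arcs_ends G"
  shows "d r v = Suc (d r u) \<or> d r u = Suc (d r v)"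
proof -
  have "u \<noteq> v" using assms(2) adj_not_same by blast
  have "d r u \<noteq> d r v"
  proof
    assume "d r u = d r v"
    then obtain p where "apath u p v" "2 \<le> length p"
      using ex_apath_same_level[OF assms(1) adj_in_verts[OF assms(2)] \<open>u \<noteq> v\<close> _ refl] by blast
    then show False using adj_not_apath adj_sym[OF assms(2)] by blast
  qed
  then show ?thesis
    using adj_dist_le[OF assms] adj_dist_le[OF assms(1) adj_sym[OF assms(2)]] by linarith
qed

text \<open>Two distinct parents are joined by a path that never goes beyond their own level. It
  misses \<open>v\<close>, so the two arcs at \<open>v\<close> close it to a cycle.\<close>

lemma parent_unique:
  assumes "r \<in> verts G" "(p, v) \<in> arcs_ends G" "(q, v) \<in> arcs_ends G"
    and "d r v = Suc (d r p)" "d r v = Suc (d r q)"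
  shows "p = q"
proof (rule ccontr)
  assume "p \<noteq> q"
  then obtain s where s: "apath p s q" "2 \<le> length s"
    "\<forall>z \<in> set (awalk_verts p s). d r z \<le> d r p"
    using ex_apath_same_level[of r p q "d r p"] assms adj_in_verts[OF assms(2)]
      adj_in_verts[OF assms(3)] by auto
  obtain e where e: "e \<in> arcs G" "tail G e = v" "head G e = p"
    using adj_sym[OF assms(2)] by (rule reachableE)
  have "v \<notin> set (awalk_verts p s)" using s(3) assms(4) by auto
  then have "apath v (e # s) q" using s e by (simp add: apath_Cons_iff)
  moreover have "2 \<le> length (e # s)" using s(2) by simp
  ultimately have "(q, v) \<notin> arcs_ends G" by (rule adj_not_apath)
  with assms(3) show False by contradiction
qed

text \<open>A tree is bipartite: each arc changes the level by exactly one, so every step of a walk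
  flips the parity of the level.\<close>

lemma relpow_level_parity:
  assumes "r \<in> verts G" "(u, v) \<in> arcs_ends G ^^ k"
  shows "even (k + d r u + d r v)"
  using assms(2)
proof (induct k arbitrary: v)
  case (Suc k)
  then obtain w where w: "(u, w) \<in> arcs_ends G ^^ k" "(w, v) \<in> arcs_ends G" by auto
  show ?case using Suc.hyps[OF w(1)] adj_level[OF assms(1) w(2)] by auto
qed simp

text \<open>In the tree rooted at \<open>r\<close>, \<open>c\<close> lies on the geodesic from
  \<open>r\<close> to \<open>v\<close>, possibly at its end. Equality in the triangle inequality
  expresses this without naming a path.\<close>

definition ancestor :: "'a \<Rightarrow> 'a \<Rightarrow> 'a \<Rightarrow> bool" where
  "ancestor r c v \<longleftrightarrow> c \<in> verts G \<and> v \<in> verts G \<and> d r v = d r c + d c v"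

lemma ancestor_refl: "v \<in> verts G \<Longrightarrow> ancestor r v v"
  by (simp add: ancestor_def)

lemma ancestor_trans:
  assumes "r \<in> verts G" "ancestor r b c" "ancestor r c v"
  shows "ancestor r b v"
  using assms dist_triangle[of b c v] dist_triangle[of r b v]
  by (auto simp: ancestor_def)

lemma parent_ancestor:
  assumes "r \<in> verts G" "(p, v) \<in> arcs_ends G" "d r v = Suc (d r p)"
  shows "ancestor r p v"
  using assms adj_in_verts[OF assms(2)] adj_dist_le[of p p v] dist_triangle[of r p v]
  by (auto simp: ancestor_def)

lemma ancestor_parent:
  assumes "r \<in> verts G" "(p, v) \<in> arcs_ends G" "d r v = Suc (d r p)"
    and "ancestor r c v" "c \<noteq> v"
  shows "ancestor r c p"
proof -
  have verts: "c \<in> verts G" "v \<in> verts G" using assms(4) by (auto simp: ancestor_def)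
  have "d c v \<noteq> 0" using dist_eq_0_imp_eq verts assms(5) by blast
  then obtain k where k: "d c v = Suc k" using not0_implies_Suc by blast
  obtain q where q: "d c q = k" "(q, v) \<in> arcs_ends G"
    using geodesic_last_arc[OF verts k] .
  have "q \<in> verts G" using q adj_in_verts by auto
  \<comment> \<open>The triangle inequality gives \<open>d r q\<close> at most
    \<open>d r c + k\<close>, and adjacency gives \<open>d r q\<close> at least
    \<open>d r v - 1\<close>, which is the same number.\<close>
  then have rq: "d r v = Suc (d r q)" "d r q = d r c + d c q"
    using dist_triangle[of r c q] adj_level[OF assms(1) q(2)] adj_dist_le[OF assms(1) q(2)]
      assms(1,4) q(1) k verts by (auto simp: ancestor_def)
  then have "q = p" using parent_unique[OF assms(1) q(2) assms(2)] assms(3) by simp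
  then show ?thesis using rq verts \<open>q \<in> verts G\<close> by (simp add: ancestor_def)
qed

text \<open>The ancestors of \<open>v\<close> form a chain. As long as \<open>v\<close> lies
  strictly below \<open>c\<close> it also differs from \<open>b\<close>, so both remain ancestors of
  its parent; the climb ends at \<open>c\<close>.\<close>

lemma ancestors_comparable:
  assumes "r \<in> verts G" "ancestor r b v" "ancestor r c v" "d r b \<le> d r c"
  shows "ancestor r b c"
  using assms(2,3)
proof (induct "d r v" arbitrary: v rule: less_induct)
  case less
  show ?case
  proof (cases "c = v")
    case True
    then show ?thesis using less.prems by simp
  next
    case False
    have verts: "c \<in> verts G" "v \<in> verts G" using less.prems by (auto simp: ancestor_def)
    then have "d c v \<noteq> 0" using dist_eq_0_imp_eq False by blast
    then have "d r c < d r v" using less.prems by (auto simp: ancestor_def)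
    then have "b \<noteq> v" using assms(4) by auto
    obtain k where "d r v = Suc k" using \<open>d r c < d r v\<close> by (cases "d r v") auto
    then obtain p where p: "d r v = Suc (d r p)" "(p, v) \<in> arcs_ends G"
      using geodesic_last_arc[OF assms(1) verts(2)] by metis
    have "ancestor r b p" "ancestor r c p"
      using ancestor_parent[OF assms(1) p(2,1)] less.prems False \<open>b \<noteq> v\<close> by auto
    then show ?thesis using less.hyps p by auto
  qed
qed

text \<open>Any walk from \<open>u\<close> to \<open>v\<close> has to climb to a common ancestor and
  descend again. The induction follows this ancestor while arcs are put in front of the
  walk.\<close>

lemma relpow_common_ancestor:
  assumes "r \<in> verts G" "(u, v) \<in> arcs_ends G ^^ k" "u \<in> verts G"
  shows "\<exists>c. ancestor r c u \<and> ancestor r c v \<and> d r u + d r v \<le> k + 2 * d r c"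
  using assms(2,3)
proof (induct k arbitrary: u)
  case 0
  then show ?case by (intro exI[of _ u]) (auto simp: ancestor_refl)
next
  case (Suc k)
  from Suc.prems(1) obtain w where w: "(u, w) \<in> arcs_ends G" "(w, v) \<in> arcs_ends G ^^ k"
    by (meson relpow_Suc_D2)
  then obtain c where c: "ancestor r c w" "ancestor r c v" "d r w + d r v \<le> k + 2 * d r c"
    using Suc.hyps adj_in_verts(2) by meson
  \<comment> \<open>The ancestor \<open>c\<close> survives the new arc, except when \<open>u\<close>
    is the parent of \<open>w\<close> and \<open>c\<close> is \<open>w\<close> itself; then
    \<open>u\<close> takes its place.\<close>
  consider "d r u = Suc (d r w)" | "d r w = Suc (d r u)" "c = w" | "d r w = Suc (d r u)" "c \<noteq> w"
    using adj_level[OF assms(1) w(1)] by blast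
  then show ?case
  proof cases
    case 1
    then have "ancestor r c u"
      using c(1) parent_ancestor[OF assms(1) adj_sym[OF w(1)]] ancestor_trans[OF assms(1)] by blast
    then show ?thesis using 1 c by (intro exI[of _ c]) auto
  next
    case 2
    then have "ancestor r u v"
      using c(2) parent_ancestor[OF assms(1) w(1)] ancestor_trans[OF assms(1)] by blast
    then show ?thesis using 2 c Suc.prems by (intro exI[of _ u]) (auto simp: ancestor_refl)
  next
    case 3
    then have "ancestor r c u" using ancestor_parent[OF assms(1) w(1)] c(1) by blast
    then show ?thesis using 3 c by (intro exI[of _ c]) auto
  qed
qed

lemma common_ancestor:
  assumes "r \<in> verts G" "u \<in> verts G" "v \<in> verts G"
  obtains c where "ancestor r c u" "ancestor r c v" "d r u + d r v \<le> d u v + 2 * d r c"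
  using relpow_common_ancestor[OF assms(1) dist_relpow[OF assms(2,3)] assms(2)] by blast

lemma dist_le_via_ancestor:
  assumes "ancestor r c u" "ancestor r c v"
  shows "d u v + 2 * d r c \<le> d r u + d r v"
  using assms dist_triangle[of u c v] dist_commute[of u c] by (auto simp: ancestor_def)

section \<open>Diametral pairs\<close>

text \<open>Root the tree at \<open>a\<close>. The geodesics to \<open>u\<close> and
  \<open>w\<close> leave the one to \<open>b\<close> at \<open>c\<close> and \<open>e\<close>, which
  are comparable as ancestors of \<open>b\<close>. The one nearer to \<open>a\<close> is thus a
  common ancestor of \<open>u\<close> and \<open>w\<close>, and the route through it is compared
  with the diameter.\<close>

lemma dist_le_max_diametral:
  assumes "a \<in> verts G" "b \<in> verts G" "u \<in> verts G" "w \<in> verts G"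
    and diam: "\<And>x y. x \<in> verts G \<Longrightarrow> y \<in> verts G \<Longrightarrow> d x y \<le> d a b"
  shows "d u w \<le> max (d a u) (d u b)"
proof -
  obtain c where c: "ancestor a c u" "ancestor a c b" "d a u + d a b \<le> d u b + 2 * d a c"
    using common_ancestor assms by blast
  obtain e where e: "ancestor a e w" "ancestor a e b" "d a w + d a b \<le> d w b + 2 * d a e"
    using common_ancestor assms by blast
  show ?thesis
  proof (cases "d a c \<le> d a e")
    case True
    then have "ancestor a c w"
      using ancestors_comparable ancestor_trans assms(1) c e by blast
    \<comment> \<open>Here \<open>d u w\<close> is at most \<open>d a u + d a w - 2 * d a c\<close>;
      replacing \<open>d a w\<close> by the larger \<open>d a b\<close> leaves at most
      \<open>d u b\<close>.\<close>
    from dist_le_via_ancestor[OF c(1) this] show ?thesis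
      using c(3) diam[OF assms(1,4)] by linarith
  next
    case False
    then have "ancestor a e u"
      using ancestors_comparable[OF assms(1) e(2) c(2)] ancestor_trans[OF assms(1) _ c(1)] by simp
    \<comment> \<open>Here \<open>d u w\<close> is at most \<open>d a u + d w b - d a b\<close>,
      hence at most \<open>d a u\<close>.\<close>
    from dist_le_via_ancestor[OF this e(1)] show ?thesis
      using e(3) diam[OF assms(4,2)] by linarith
  qed
qed

text \<open>All vertices on a geodesic from \<open>a\<close> to \<open>b\<close> are ancestors of
  \<open>b\<close> for the root \<open>a\<close>, hence comparable, so each level holds only one.
  This counts the vertices of the path and lets sums over it be indexed by the distance from
  \<open>a\<close>.\<close>

lemma bij_betw_geodesic:
  assumes "a \<in> verts G" "b \<in> verts G"
  shows "bij_betw (d a) {u \<in> verts G. d a u + d u b = d a b} {..d a b}"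
proof (rule bij_betwI')
  let ?P = "{u \<in> verts G. d a u + d u b = d a b}"
  fix u v assume uv: "u \<in> ?P" "v \<in> ?P"
  show "(d a u = d a v) = (u = v)"
  proof
    assume eq: "d a u = d a v"
    have "ancestor a u b" "ancestor a v b" using uv assms by (auto simp: ancestor_def)
    then have "ancestor a u v" by (rule ancestors_comparable[OF assms(1)]) (simp add: eq)
    then have "d u v = 0" using eq by (simp add: ancestor_def)
    then show "u = v" using dist_eq_0_imp_eq uv by simp
  qed simp
next
  fix u assume "u \<in> {u \<in> verts G. d a u + d u b = d a b}"
  then show "d a u \<in> {..d a b}" by simp
next
  fix i assume "i \<in> {..d a b}"
  then obtain j where j: "d a b = i + j" using le_Suc_ex by auto
  from geodesic_split[OF assms j] obtain w where "w \<in> verts G" "d a w = i" "d w b = j" .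
  then show "\<exists>u \<in> {u \<in> verts G. d a u + d u b = d a b}. i = d a u"
    using j by auto
qed

lemma off_geodesic_abs_diff_le:
  assumes "a \<in> verts G" "b \<in> verts G" "u \<in> verts G" "d a u + d u b \<noteq> d a b"
    and "d a u \<le> d a b" "d u b \<le> d a b"
  shows "\<bar>real (d a u) - real (d u b)\<bar> \<le> real (d a b) - 2"
proof -
  have "even (d u b + d a u + d a b)"
    by (rule relpow_level_parity[OF assms(1) dist_relpow[OF assms(3,2)]])
  then have "even (d a u + d u b + d a b)" by (simp add: ac_simps)
  moreover have "d a b \<le> d a u + d u b" using dist_triangle[OF assms(1,3,2)] .
  ultimately have "d a b + 2 \<le> d a u + d u b"
    using assms(4) by presburger
  \<comment> \<open>The larger distance is at most the diameter, so the sum forces the smaller one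
    to be at least 2.\<close>
  then show ?thesis using assms(5,6) by linarith
qed

lemma eccentricity_le_max_diametral:
  assumes "a \<in> verts G" "b \<in> verts G" "u \<in> verts G"
    and "\<And>x y. x \<in> verts G \<Longrightarrow> y \<in> verts G \<Longrightarrow> d x y \<le> d a b"
  shows "eccentricity G u \<le> max (d a u) (d u b)"
  unfolding eccentricity_def
proof (rule Max.boundedI)
  show "d u ` verts G \<noteq> {}" using verts_nonempty by simp
next
  fix k assume "k \<in> d u ` verts G"
  then obtain w where "w \<in> verts G" "k = d u w" by blast
  then show "k \<le> max (d a u) (d u b)"
    using dist_le_max_diametral[OF assms(1,2,3) _ assms(4)] by simp
qed simp

end

section \<open>Real estimates: remoteness and the path sum \<open>spread\<close>\<close>

lemma normalized_transmission_le_remoteness: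
  assumes "finite (verts G)" "v \<in> verts G"
  shows "normalized_transmission G v \<le> remoteness G"
  unfolding remoteness_def using assms by (intro Max_ge) auto

text \<open>On a path with vertices \<open>0\<close> to \<open>m\<close>, vertex \<open>i\<close>
  has distances \<open>i\<close> and \<open>m - i\<close> to the ends; the summand is the absolute
  difference of the two.\<close>

definition spread :: "nat \<Rightarrow> real" where
  "spread m = (\<Sum>i\<le>m. \<bar>2 * real i - real m\<bar>)"

text \<open>Twice \<open>2 * i - m\<close> is the sum of two neighbouring terms
  \<open>2 * i - (m + 1)\<close> and \<open>2 * (i + 1) - (m + 1)\<close>. Summing the triangle
  inequality counts every term of the longer path twice, except the two end terms, both
  \<open>m + 1\<close>, which are counted once.\<close>

lemma spread_Suc_ge: "spread m + real (Suc m) \<le> spread (Suc m)"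
proof -
  let ?f = "\<lambda>i. \<bar>2 * real i - real (Suc m)\<bar>"
  have "2 * spread m = (\<Sum>i\<le>m. 2 * \<bar>2 * real i - real m\<bar>)"
    by (simp add: spread_def sum_distrib_left)
  also have "\<dots> \<le> (\<Sum>i\<le>m. ?f i + ?f (Suc i))"
    by (rule sum_mono) (simp add: abs_if)
  also have "\<dots> = (\<Sum>i\<le>m. ?f i) + (\<Sum>i\<le>m. ?f (Suc i))"
    by (rule sum.distrib)
  also have "(\<Sum>i\<le>m. ?f i) = spread (Suc m) - real (Suc m)"
    by (simp add: spread_def)
  also have "(\<Sum>i\<le>m. ?f (Suc i)) = spread (Suc m) - real (Suc m)"
    unfolding spread_def sum.atMost_Suc_shift[of ?f m] by simp
  finally show ?thesis by simp
qed

lemma spread_add_ge: "spread m + real k * (real m + 1) \<le> spread (m + k)"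
proof (induct k)
  case (Suc k)
  have "real m + 1 \<le> real (Suc (m + k))" by simp
  with Suc spread_Suc_ge[of "m + k"] show ?case by (simp add: algebra_simps)
qed simp

section \<open>Upper bound for a tree in terms of its diameter\<close>

context acyclic_graph
begin

lemma diameter_less_card:
  assumes "a \<in> verts G" "b \<in> verts G"
  shows "d a b < card (verts G)"
proof -
  have "Suc (d a b) = card {u \<in> verts G. d a u + d u b = d a b}"
    using bij_betw_same_card[OF bij_betw_geodesic[OF assms]] by simp
  also have "\<dots> \<le> card (verts G)" by (rule card_mono) auto
  finally show ?thesis by simp
qed

lemma sum_abs_diff_le:
  assumes "a \<in> verts G" "b \<in> verts G"
    and diam: "\<And>x y. x \<in> verts G \<Longrightarrow> y \<in> verts G \<Longrightarrow> d x y \<le> d a b"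
  shows "(\<Sum>u\<in>verts G. \<bar>real (d a u) - real (d u b)\<bar>)
    \<le> spread (d a b) + (real (card (verts G)) - real (d a b) - 1) * (real (d a b) - 2)"
proof -
  let ?P = "{u \<in> verts G. d a u + d u b = d a b}"
  let ?g = "\<lambda>u. \<bar>real (d a u) - real (d u b)\<bar>"
  have bij: "bij_betw (d a) ?P {..d a b}" by (rule bij_betw_geodesic[OF assms(1,2)])
  have card_P: "card ?P = Suc (d a b)" using bij_betw_same_card[OF bij] by simp
  have "sum ?g ?P = (\<Sum>u\<in>?P. \<bar>2 * real (d a u) - real (d a b)\<bar>)"
  proof (rule sum.cong)
    fix u assume "u \<in> ?P"
    then have "real (d a b) = real (d a u) + real (d u b)" by (simp flip: of_nat_add)
    then show "?g u = \<bar>2 * real (d a u) - real (d a b)\<bar>" by simp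
  qed simp
  also have "\<dots> = spread (d a b)"
    unfolding spread_def
    using sum.reindex_bij_betw[OF bij, of "\<lambda>i. \<bar>2 * real i - real (d a b)\<bar>"] .
  finally have on: "sum ?g ?P = spread (d a b)" .
  have "sum ?g (verts G - ?P) \<le> of_nat (card (verts G - ?P)) * (real (d a b) - 2)"
  proof (rule sum_bounded_above)
    fix u assume "u \<in> verts G - ?P"
    then show "?g u \<le> real (d a b) - 2"
      using off_geodesic_abs_diff_le[OF assms(1,2)] diam[OF assms(1)] diam[OF _ assms(2)] by simp
  qed
  also have "card (verts G - ?P) = card (verts G) - Suc (d a b)"
    using card_P by (subst card_Diff_subset) auto
  also have "real (card (verts G) - Suc (d a b)) = real (card (verts G)) - real (d a b) - 1"
    using diameter_less_card[OF assms(1,2)] by (simp add: of_nat_diff)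
  finally have off: "sum ?g (verts G - ?P)
      \<le> (real (card (verts G)) - real (d a b) - 1) * (real (d a b) - 2)" .
  have "sum ?g (verts G) = sum ?g (verts G - ?P) + sum ?g ?P"
    by (rule sum.subset_diff) auto
  with on off show ?thesis by simp
qed

lemma average_eccentricity_minus_remoteness_le:
  fixes n :: real
  assumes "a \<in> verts G" "b \<in> verts G"
    and diam: "\<And>x y. x \<in> verts G \<Longrightarrow> y \<in> verts G \<Longrightarrow> d x y \<le> d a b"
    and n: "n = real (card (verts G))" "n > 1"
  shows "average_eccentricity G - remoteness G
    \<le> (spread (d a b) + (n - real (d a b) - 1) * (real (d a b) - 2)) / (2 * n)
      - real (d a b) / (2 * (n - 1))"
proof -
  let ?D = "real (d a b)"
  define W where "W = (\<Sum>u\<in>verts G. real (d a u) + real (d u b))"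
  define E where "E = (\<Sum>u\<in>verts G. real (eccentricity G u))"
  define B where "B = spread (d a b) + (n - ?D - 1) * (?D - 2)"
  have "2 * E \<le> (\<Sum>u\<in>verts G. (real (d a u) + real (d u b)) + \<bar>real (d a u) - real (d u b)\<bar>)"
    unfolding E_def sum_distrib_left
  proof (rule sum_mono)
    fix u assume "u \<in> verts G"
    then have "real (eccentricity G u) \<le> max (real (d a u)) (real (d u b))"
      using eccentricity_le_max_diametral[OF assms(1,2) _ diam] by (metis of_nat_max of_nat_mono)
    then show "2 * real (eccentricity G u)
        \<le> (real (d a u) + real (d u b)) + \<bar>real (d a u) - real (d u b)\<bar>" by linarith
  qed
  also have "\<dots> \<le> W + B"
    using sum_abs_diff_le[OF assms(1,2) diam] by (simp add: sum.distrib W_def B_def n(1))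
  finally have E: "2 * E \<le> W + B" .
  have "(\<Sum>u\<in>verts G. ?D) \<le> W"
    unfolding W_def
  proof (rule sum_mono)
    fix u assume "u \<in> verts G"
    from dist_triangle[OF assms(1) this assms(2)]
    show "?D \<le> real (d a u) + real (d u b)" by linarith
  qed
  then have W: "n * ?D \<le> W" by (simp add: n(1))
  have "W = (\<Sum>u\<in>verts G. real (d a u)) + (\<Sum>u\<in>verts G. real (d b u))"
    unfolding W_def sum.distrib using dist_commute[OF assms(2)] by simp
  then have "W / (n - 1) = normalized_transmission G a + normalized_transmission G b"
    by (simp add: normalized_transmission_def n(1) add_divide_distrib)
  also have "\<dots> \<le> 2 * remoteness G"
    using normalized_transmission_le_remoteness[OF finite_verts] assms(1,2)
    by (smt (verit, best))
  finally have R: "W / (2 * (n - 1)) \<le> remoteness G" using n(2) by (simp add: field_simps)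
  have "average_eccentricity G = E / n" by (simp add: average_eccentricity_def E_def n(1))
  also have "\<dots> \<le> (W + B) / (2 * n)" using E n(2) by (simp add: field_simps)
  finally have "average_eccentricity G - remoteness G \<le> (W + B) / (2 * n) - W / (2 * (n - 1))"
    using R by linarith
  \<comment> \<open>The total coefficient of \<open>W\<close> is negative, so the lower bound on
    \<open>W\<close> may now be inserted.\<close>
  also have "\<dots> = B / (2 * n) - W / (2 * n * (n - 1))"
    using n(2) by (simp add: field_simps)
  also have "\<dots> \<le> B / (2 * n) - (n * ?D) / (2 * n * (n - 1))"
    using n(2) by (intro diff_left_mono divide_right_mono W) simp
  also have "(n * ?D) / (2 * n * (n - 1)) = ?D / (2 * (n - 1))"
    using n(2) by simp
  finally show ?thesis by (simp add: B_def)
qed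

lemma ex_diametral_pair:
  obtains a b where "a \<in> verts G" "b \<in> verts G"
    "\<And>x y. x \<in> verts G \<Longrightarrow> y \<in> verts G \<Longrightarrow> d x y \<le> d a b"
proof -
  let ?S = "case_prod d ` (verts G \<times> verts G)"
  have fin: "finite ?S" by simp
  moreover have "?S \<noteq> {}" using verts_nonempty by simp
  ultimately have "Max ?S \<in> ?S" by (rule Max_in)
  then obtain a b where ab: "a \<in> verts G" "b \<in> verts G" "Max ?S = d a b" by auto
  have "d x y \<le> d a b" if "x \<in> verts G" "y \<in> verts G" for x y
  proof -
    have "d x y \<in> ?S" using that by (intro image_eqI[of _ _ "(x, y)"]) auto
    then show ?thesis using Max_ge[OF fin] ab(3) by simp
  qed
  with ab that show thesis by blast
qed

end

section \<open>The path graph\<close>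

lemma wf_path_graph: "wf_digraph (with_proj (path_graph n))"
  by unfold_locales (auto simp: path_graph_def)

lemma path_graph_relpow_abs_diff_le:
  assumes "(i, j) \<in> parcs (path_graph n) ^^ k"
  shows "\<bar>int i - int j\<bar> \<le> int k"
  using assms
proof (induct k arbitrary: j)
  case (Suc k)
  then obtain w where "(i, w) \<in> parcs (path_graph n) ^^ k" "(w, j) \<in> parcs (path_graph n)" by auto
  with Suc.hyps[of w] show ?case by (auto simp: path_graph_def)
qed simp

lemma path_graph_relpow_up:
  assumes "i + k < n"
  shows "(i, i + k) \<in> parcs (path_graph n) ^^ k"
  using assms
proof (induct k)
  case (Suc k)
  then have "(i, i + k) \<in> parcs (path_graph n) ^^ k"
    "(i + k, i + Suc k) \<in> parcs (path_graph n)" by (auto simp: path_graph_def)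
  then show ?case by (rule relpow_Suc_I)
qed simp

lemma path_graph_relpow_down:
  assumes "i + k < n"
  shows "(i + k, i) \<in> parcs (path_graph n) ^^ k"
  using assms
proof (induct k)
  case (Suc k)
  then have "(i + k, i) \<in> parcs (path_graph n) ^^ k"
    "(i + Suc k, i + k) \<in> parcs (path_graph n)" by (auto simp: path_graph_def)
  then show ?case by (intro relpow_Suc_I2)
qed simp

text \<open>The walk that runs straight from \<open>i\<close> to \<open>j\<close> has this length,
  and no walk is shorter because each arc changes the number of the vertex by one.\<close>

lemma path_graph_dist:
  assumes "i < n" "j < n"
  shows "graph_dist (with_proj (path_graph n)) i j = nat \<bar>int i - int j\<bar>"
proof -
  interpret P: wf_digraph "with_proj (path_graph n)" by (rule wf_path_graph)
  let ?k = "nat \<bar>int i - int j\<bar>"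
  have path: "(i, j) \<in> parcs (path_graph n) ^^ ?k"
  proof (cases "i \<le> j")
    case True
    then have "j = i + ?k" by simp
    with path_graph_relpow_up[of i ?k n] assms(2) show ?thesis by metis
  next
    case False
    then have "i = j + ?k" by simp
    with path_graph_relpow_down[of j ?k n] assms(1) show ?thesis by metis
  qed
  have i: "i \<in> verts (with_proj (path_graph n))" using assms by (simp add: path_graph_def)
  have "i \<rightarrow>\<^sup>*\<^bsub>with_proj (path_graph n)\<^esub> j"
    unfolding P.reachable_conv'[OF i] using relpow_imp_rtrancl[OF path] by simp
  then have "graph_dist (with_proj (path_graph n)) i j
      = (LEAST k. (i, j) \<in> parcs (path_graph n) ^^ k)"
    using P.graph_dist_eq_Least_relpow[OF i] by simp
  also have "\<dots> = ?k"
    using path path_graph_relpow_abs_diff_le[of i j _ n] by (intro Least_equality) force+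
  finally show ?thesis .
qed

text \<open>The ends \<open>0\<close> and \<open>m\<close> are at distances \<open>i\<close> and
  \<open>m - i\<close>, and twice the maximum of these is their sum \<open>m\<close> plus their
  absolute difference.\<close>

lemma path_graph_eccentricity_ge:
  assumes "i \<le> m"
  shows "real m + \<bar>2 * real i - real m\<bar>
    \<le> 2 * real (eccentricity (with_proj (path_graph (Suc m))) i)"
proof -
  let ?P = "with_proj (path_graph (Suc m))"
  have "graph_dist ?P i j \<le> eccentricity ?P i" if "j \<le> m" for j
    unfolding eccentricity_def using that by (intro Max_ge) (auto simp: path_graph_def)
  from this[of 0] this[of m] show ?thesis
    using assms by (simp add: path_graph_dist)
qed

lemma average_eccentricity_path_graph_ge:
  "(real m + spread m / real (Suc m)) / 2
    \<le> average_eccentricity (with_proj (path_graph (Suc m)))"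
proof -
  let ?P = "with_proj (path_graph (Suc m))"
  have "real (Suc m) * real m + spread m = (\<Sum>i\<le>m. real m + \<bar>2 * real i - real m\<bar>)"
    by (simp add: spread_def sum.distrib)
  also have "\<dots> \<le> (\<Sum>i\<le>m. 2 * real (eccentricity ?P i))"
    by (rule sum_mono) (simp add: path_graph_eccentricity_ge)
  also have "\<dots> = 2 * (real (Suc m) * average_eccentricity ?P)"
    by (simp add: average_eccentricity_def path_graph_def lessThan_Suc_atMost sum_distrib_left)
  finally show ?thesis by (simp add: field_simps)
qed

text \<open>This bounds the transmission of vertex \<open>i\<close> of the path by that of an end
  vertex, \<open>0 + 1 + ... + m\<close>.\<close>

lemma sum_abs_diff_atMost_le:
  assumes "i \<le> m"
  shows "(\<Sum>j\<le>m. \<bar>real i - real j\<bar>) \<le> real m * (real m + 1) / 2"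
  using assms
proof (induct m arbitrary: i)
  case (Suc m)
  show ?case
  proof (cases "i = Suc m")
    case True
    \<comment> \<open>Splitting off \<open>j = 0\<close> and shifting the index reduces the new end
      vertex to the end vertex of the shorter path.\<close>
    have "(\<Sum>j\<le>Suc m. \<bar>real i - real j\<bar>) = real (Suc m) + (\<Sum>j\<le>m. \<bar>real m - real j\<bar>)"
      unfolding True sum.atMost_Suc_shift by simp
    then show ?thesis using Suc.hyps[of m] by (simp add: field_simps)
  next
    case False
    then have "(\<Sum>j\<le>m. \<bar>real i - real j\<bar>) \<le> real m * (real m + 1) / 2"
      "\<bar>real i - real (Suc m)\<bar> \<le> real m + 1"
      using Suc by auto
    then show ?thesis by (simp add: field_simps)
  qed
qed simp

lemma remoteness_path_graph_le:
  assumes "m > 0"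
  shows "remoteness (with_proj (path_graph (Suc m))) \<le> (real m + 1) / 2"
  unfolding remoteness_def
proof (rule Max.boundedI)
  let ?P = "with_proj (path_graph (Suc m))"
  fix x assume "x \<in> normalized_transmission ?P ` verts ?P"
  moreover have V: "verts ?P = {..m}" by (auto simp: path_graph_def)
  ultimately obtain i where i: "i \<le> m" "x = normalized_transmission ?P i" by auto
  have "(\<Sum>j\<in>verts ?P. real (graph_dist ?P i j)) = (\<Sum>j\<le>m. \<bar>real i - real j\<bar>)"
    unfolding V using i(1) by (intro sum.cong) (auto simp: path_graph_dist)
  then have "x = (\<Sum>j\<le>m. \<bar>real i - real j\<bar>) / real m"
    unfolding i(2) normalized_transmission_def V by simp
  also have "\<dots> \<le> (real m * (real m + 1) / 2) / real m"
    using sum_abs_diff_atMost_le[OF i(1)] by (rule divide_right_mono) simp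
  finally show "x \<le> (real m + 1) / 2" using assms by simp
qed (auto simp: path_graph_def)

section \<open>Comparison of the tree with the path\<close>

theorem theorem12:
  fixes G :: "('a, 'b) pre_digraph" and n :: nat
  assumes "simple_tree G"
    and "card (verts G) = n"
    and "n \<ge> 3"
  shows "average_eccentricity G - remoteness G
    \<le> average_eccentricity (with_proj (path_graph n)) - remoteness (with_proj (path_graph n))"
proof -
  have G: "graph G" "Digraph_Component.connected G"
    "\<And>p. pre_digraph.cycle G p \<Longrightarrow> length p < 3"
    using assms(1) by (auto simp: simple_tree_def not_le)
  then interpret acyclic_graph G
    by (intro acyclic_graph.intro connected_graph.intro connected_graph_axioms.intro
        acyclic_graph_axioms.intro)
  obtain a b where ab: "a \<in> verts G" "b \<in> verts G"
    "\<And>x y. x \<in> verts G \<Longrightarrow> y \<in> verts G \<Longrightarrow> d x y \<le> d a b"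
    using ex_diametral_pair by blast
  \<comment> \<open>\<open>k\<close> is the number of vertices off the diametral path.\<close>
  obtain k where k: "n = Suc (d a b + k)"
    using diameter_less_card[OF ab(1,2)] assms(2) less_imp_Suc_add by metis
  define m where "m = d a b + k"
  define D where "D = real (d a b)"
  have m: "n = Suc m" "real m = D + real k" "real m \<ge> 2"
    using k assms(3) by (auto simp: m_def D_def)
  have "average_eccentricity G - remoteness G
      \<le> (spread (d a b) + real k * (D - 2)) / (2 * (real m + 1)) - D / (2 * real m)"
    using average_eccentricity_minus_remoteness_le[OF ab, of "real n"] assms(2,3) m
    by (simp add: D_def add.commute)
  also have "\<dots> \<le> (real m + spread m / (real m + 1)) / 2 - (real m + 1) / 2"
  proof -
    \<comment> \<open>A vertex off the diametral path is counted with \<open>D - 2\<close>, whereas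
      lengthening the path by one vertex adds at least \<open>D + 1\<close> to
      \<open>spread\<close>: a surplus of 3 for each of the \<open>k\<close> vertices.\<close>
    have "spread (d a b) + real k * (D - 2) \<le> spread m - 3 * real k"
      using spread_add_ge[of "d a b" k] by (simp add: m_def D_def algebra_simps)
    then have "(spread (d a b) + real k * (D - 2)) / (2 * (real m + 1))
        \<le> (spread m - 3 * real k) / (2 * (real m + 1))"
      by (rule divide_right_mono) simp
    also have "\<dots> = spread m / (real m + 1) / 2 - 3 * real k / (2 * (real m + 1))"
      by (simp add: diff_divide_distrib)
    finally have "(spread (d a b) + real k * (D - 2)) / (2 * (real m + 1))
        \<le> spread m / (real m + 1) / 2 - 3 * real k / (2 * (real m + 1))" .
    \<comment> \<open>The surplus pays for the remoteness term: \<open>D / (2 * m)\<close> falls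
      short of its value 1/2 for the path by exactly \<open>k / (2 * m)\<close>.\<close>
    moreover have "real k / (2 * real m) \<le> 3 * real k / (2 * (real m + 1))"
    proof -
      have "real k * (real m + 1) \<le> real k * (3 * real m)"
        using m(3) by (intro mult_left_mono) auto
      then show ?thesis using m(3) by (simp add: field_simps)
    qed
    moreover have "D / (2 * real m) = 1 / 2 - real k / (2 * real m)"
      using m(2,3) by (simp add: field_simps)
    \<comment> \<open>With the quotients replaced by variables, the combination of the three facts
      is linear.\<close>
    moreover have "x - z \<le> (real m + S) / 2 - (real m + 1) / 2"
      if "x \<le> S / 2 - y" "t \<le> y" "z = 1 / 2 - t" for x y z t S :: real
      using that by argo
    ultimately show ?thesis by blast
  qed
  also have "\<dots> \<le> average_eccentricity (with_proj (path_graph n))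
      - remoteness (with_proj (path_graph n))"
    using average_eccentricity_path_graph_ge[of m] remoteness_path_graph_le[of m] m(3)
    unfolding m(1) of_nat_Suc by (intro diff_mono) (simp_all add: add.commute)
  finally show ?thesis .
qed

end
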